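(* Every boundary-compatible primitive scar intensity belongs to $\mathcal M_G^{\mathrm{bc}}$. More precisely, for every simple cycle or simple exterior-to-exterior path $K$ in $G$, with any fixed endpoint type $DD,DN,ND$ or $NN$ (Dirichlet/Neumann) in the path case, there are a boundary-compatible singular sector $\sigma$ and a nonzero $A^K\in\ker B_{\sigma,\mathrm{bc}}$ such that $$(A^K_e)^2=\begin{cases}1,&e\subset K,\\0,&e\not\subset K.\end{cases}$$ After normalization by $\ell\cdot(A^K)^{\circ2}=L_K$, where $L_K=\sum_{e\subset K}\ell_e$, this gives the primitive arclength intensity $L_K^{-1}\mathbf 1_K\in\mathcal M_G^{\mathrm{bc}}$, where $\mathbf 1_K\in\{0,1\}^E$ is the indicator vector of the edges of $K$.
   Context: Let $G=(V,E)$ be a finite metric graph (loops and multiple edges allowed) with edge lengths $\ell_e>0$, whose vertices are split into internal vertices $V_{\mathrm{int}}$ (standard Kirchhoff conditions) and degree-one exterior vertices, each carrying a Dirichlet or a Neumann condition; every edge has at least one internal endpoint. Orient the edges, terminal edges from the internal to the exterior endpoint. A one-edge loop counts as a simple cycle. A boundary-compatible singular sector $\sigma$ consists of: a parity $\sigma_e=\cos\theta_e\in\{\pm1\}$, $\theta_e\in\pi\mathbb Z$, for each internal--internal edge; a phase class $\theta_e\in\pi\mathbb Z$ for each internal--Dirichlet edge; a phase class $\theta_e\in\frac\pi2+\pi\mathbb Z$ for each internal--Neumann edge. The matrix $B_{\sigma,\mathrm{bc}}\in\mathbb R^{V_{\mathrm{int}}\times E}$ has: for a non-loop internal--internal edge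 from $v_-$ to $v_+$, entries $1$ in row $v_-$ and $-\sigma_e$ in row $v_+$; for a loop at $v$, entry $1-\sigma_e$ in row $v$; for a terminal edge at internal vertex $v$, entry $1$ in row $v$; all other entries zero. For $A\in\mathbb R^E$, $A^{\circ2}=(A_e^2)_{e\in E}$. $\mathcal M_G^{\mathrm{bc}}$ is the convex cone generated by $\bigcup_{\sigma}\{A^{\circ2}:A\in\ker B_{\sigma,\mathrm{bc}}\}$ over all sectors $\sigma$. *)

theory Defs
  imports "HOL-Analysis.Analysis" "Graph_Theory.Arc_Walk"
begin

text \<open>
  Edges are the elements of a finite type \<open>'e\<close>, so that vectors indexed by the edges live in
  \<open>real ^ 'e\<close>.  The orientation of the edges is the one of the underlying digraph
  (\<open>tail\<close> is $v_-$, \<open>head\<close> is $v_+$), which may have loops and parallel arcs.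
\<close>

datatype bcond = Dirichlet | Neumann

record ('v, 'e) bc_graph =
  skel :: "('v, 'e) pre_digraph"
  len :: "real ^ 'e"
  vint :: "'v set"
  bc :: "'v \<Rightarrow> bcond"  \<comment> \<open>relevant on exterior vertices only\<close>

definition vext :: "('v, 'e::finite) bc_graph \<Rightarrow> 'v set" where
  "vext M = verts (skel M) - vint M"

locale metric_graph =
  fixes M :: "('v, 'e::finite) bc_graph"
  assumes fin: "fin_digraph (skel M)"
    and arcs_UNIV: "arcs (skel M) = UNIV"
    and len_pos: "\<And>e. 0 < len M $ e"
    and vint_subset: "vint M \<subseteq> verts (skel M)"
    and ext_degree_one:
      "\<And>v. v \<in> vext M \<Longrightarrow> in_degree (skel M) v + out_degree (skel M) v = 1"
    and internal_endpoint: "\<And>e. tail (skel M) e \<in> vint M \<or> head (skel M) e \<in> vint M"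
    and terminal_orientation: "\<And>e. tail (skel M) e \<notin> vext M"


text \<open>
  A sector is given by representatives \<open>\<theta>\<close> of its phases; the parity of an
  internal--internal edge \<open>e\<close> is \<open>cos (\<theta> $ e)\<close>.  Under \<open>metric_graph\<close> every tail is
  internal, so the type of an edge is determined by its head.
\<close>

definition singular_sectors :: "('v, 'e::finite) bc_graph \<Rightarrow> (real ^ 'e) set" where
  "singular_sectors M = {\<theta>. \<forall>e.
     (head (skel M) e \<in> vint M \<longrightarrow> (\<exists>k::int. \<theta> $ e = of_int k * pi)) \<and>
     (head (skel M) e \<in> vext M \<and> bc M (head (skel M) e) = Dirichlet \<longrightarrow>
        (\<exists>k::int. \<theta> $ e = of_int k * pi)) \<and>
     (head (skel M) e \<in> vext M \<and> bc M (head (skel M) e) = Neumann \<longrightarrow>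
        (\<exists>k::int. \<theta> $ e = pi / 2 + of_int k * pi))}"

text \<open>Row \<open>v\<close> of the matrix $B_{\sigma,\mathrm{bc}}$; its rows are indexed by the internal vertices.\<close>

definition scar_matrix ::
    "('v, 'e::finite) bc_graph \<Rightarrow> real ^ 'e \<Rightarrow> 'v \<Rightarrow> real ^ 'e" where
  "scar_matrix M \<theta> v = (\<chi> e.
     if head (skel M) e \<in> vint M then
       (if tail (skel M) e = head (skel M) e then
          (if v = tail (skel M) e then 1 - cos (\<theta> $ e) else 0)
        else if v = tail (skel M) e then 1
        else if v = head (skel M) e then - cos (\<theta> $ e)
        else 0)
     else (if v = tail (skel M) e then 1 else 0))"

definition scar_kernel :: "('v, 'e::finite) bc_graph \<Rightarrow> real ^ 'e \<Rightarrow> (real ^ 'e) set" where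
  "scar_kernel M \<theta> = {A. \<forall>v\<in>vint M. (\<Sum>e\<in>UNIV. scar_matrix M \<theta> v $ e * A $ e) = 0}"

definition hadamard_square :: "real ^ 'e \<Rightarrow> real ^ 'e::finite" where
  "hadamard_square A = (\<chi> e. (A $ e)\<^sup>2)"

definition scar_cone :: "('v, 'e::finite) bc_graph \<Rightarrow> (real ^ 'e) set" where
  "scar_cone M =
     convex_cone hull (\<Union>\<theta>\<in>singular_sectors M. hadamard_square ` scar_kernel M \<theta>)"


text \<open>
  Undirected walks in \<open>G\<close> are arc walks in the digraph in which each arc \<open>e\<close> is replaced by
  its two traversals \<open>(e, True)\<close> (along \<open>e\<close>) and \<open>(e, False)\<close> (against \<open>e\<close>).
\<close>

definition traversals :: "('v, 'e) pre_digraph \<Rightarrow> ('v, 'e \<times> bool) pre_digraph" where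
  "traversals G =
     \<lparr> verts = verts G, arcs = arcs G \<times> UNIV,
       tail = (\<lambda>(e, d). if d then tail G e else head G e),
       head = (\<lambda>(e, d). if d then head G e else tail G e) \<rparr>"

text \<open>
  Distinctness of the edges excludes going back and forth along a single edge, but allows
  loops and pairs of parallel edges.
\<close>

definition simple_cycle :: "('v, 'e::finite) bc_graph \<Rightarrow> ('e \<times> bool) list \<Rightarrow> bool" where
  "simple_cycle M p \<longleftrightarrow>
     pre_digraph.cycle (traversals (skel M)) p \<and> distinct (map fst p)"

definition simple_exterior_path ::
    "('v, 'e::finite) bc_graph \<Rightarrow> bcond \<Rightarrow> bcond \<Rightarrow> ('e \<times> bool) list \<Rightarrow> bool" where
  "simple_exterior_path M a b p \<longleftrightarrow>
     p \<noteq> [] \<and>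
     (\<exists>u\<in>vext M. \<exists>v\<in>vext M. bc M u = a \<and> bc M v = b \<and>
        pre_digraph.apath (traversals (skel M)) u p v)"

text \<open>Cycles and paths enter only through their edge sets.\<close>

definition primitive_edge_set :: "('v, 'e::finite) bc_graph \<Rightarrow> 'e set \<Rightarrow> bool" where
  "primitive_edge_set M K \<longleftrightarrow>
     (\<exists>p. simple_cycle M p \<and> K = fst ` set p) \<or>
     (\<exists>a b p. simple_exterior_path M a b p \<and> K = fst ` set p)"

definition edge_indicator :: "'e set \<Rightarrow> real ^ 'e::finite" where
  "edge_indicator K = (\<chi> e. if e \<in> K then 1 else 0)"

definition total_length :: "('v, 'e::finite) bc_graph \<Rightarrow> 'e set \<Rightarrow> real" where
  "total_length M K = (\<Sum>e\<in>K. len M $ e)"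

definition arclength_intensity :: "('v, 'e::finite) bc_graph \<Rightarrow> 'e set \<Rightarrow> real ^ 'e" where
  "arclength_intensity M K = inverse (total_length M K) *\<^sub>R edge_indicator K"

end

theory Submission
  imports Defs
begin

text \<open>
  Take the sector in which every internal--internal parity is \<open>+1\<close>.  Its matrix is the signed
  incidence matrix of the oriented graph, restricted to the internal vertices, so its kernel
  consists of the edge flows obeying Kirchhoff's current law there.  One such flow runs along
  \<open>K\<close>: it is \<open>+1\<close> on an edge traversed along its orientation, \<open>-1\<close> on an edge traversed against
  it, and \<open>0\<close> elsewhere.

  The divergence of the flow of a walk telescopes to its source minus its sink
  (\<open>incidence_inner_traversal_flow\<close>).  A cycle has neither, and those of an exterior path are
  exterior vertices, at which no equation is imposed.  As no edge of \<open>K\<close> is used twice, the flow is \<open>\<plusminus>1\<close> on \<open>K\<close>.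
  A repeated edge is excluded by definition in a cycle; in a path it would repeat a vertex
  (\<open>distinct_edges_of_apath\<close>).
\<close>

primrec traversal_flow :: "('e::finite \<times> bool) list \<Rightarrow> real ^ 'e" where
  "traversal_flow [] = 0"
| "traversal_flow (a # p) = (if snd a then 1 else -1) *\<^sub>R axis (fst a) 1 + traversal_flow p"

text \<open>A loop contributes \<open>1 - 1 = 0\<close> to the row of its vertex.\<close>

definition incidence :: "('v, 'e) pre_digraph \<Rightarrow> 'v \<Rightarrow> real ^ 'e::finite" where
  "incidence G v = (\<chi> e. of_bool (tail G e = v) - of_bool (head G e = v))"

text \<open>
  Reversing a traversal swaps the ends of the edge and negates its amplitude, so each step
  from \<open>x\<close> to \<open>y\<close> contributes \<open>[x = v] - [y = v]\<close> in either direction.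
\<close>

lemma incidence_inner_traversal_flow:
  fixes G :: "('v, 'e::finite) pre_digraph"
  assumes "pre_digraph.cas (traversals G) u p w"
  shows "incidence G v \<bullet> traversal_flow p = of_bool (u = v) - of_bool (w = v)"
  using assms
proof (induction p arbitrary: u)
  case Nil
  then show ?case by (simp add: pre_digraph.cas.simps)
next
  case (Cons a p)
  obtain e d where a: "a = (e, d)" by fastforce
  from Cons.prems have step: "tail (traversals G) a = u"
    and rest: "pre_digraph.cas (traversals G) (head (traversals G) a) p w"
    by (simp_all add: pre_digraph.cas.simps)
  show ?case
    using Cons.IH[OF rest] step
    by (cases d) (auto simp: a traversals_def incidence_def inner_add_right inner_diff_right inner_axis)
qed

lemma traversal_flow_eq_0:
  "e \<notin> fst ` set p \<Longrightarrow> traversal_flow p $ e = 0"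
  by (induction p) (auto simp: axis_def)

lemma traversal_flow_squared:
  assumes "distinct (map fst p)"
  shows "(traversal_flow p $ e)\<^sup>2 = (if e \<in> fst ` set p then 1 else 0)"
  using assms by (induction p) (auto simp: axis_def traversal_flow_eq_0)

text \<open>
  The first vertex of a path does not recur, but it would be an end of any later traversal,
  in either direction, of the first edge.
\<close>

lemma distinct_edges_of_apath:
  fixes G :: "('v, 'e) pre_digraph"
  assumes "wf_digraph (traversals G)" "pre_digraph.apath (traversals G) u p w"
  shows "distinct (map fst p)"
  using assms(2)
proof (induction p arbitrary: u)
  case Nil
  then show ?case by simp
next
  case (Cons a p)
  interpret T: wf_digraph "traversals G" by fact
  from Cons.prems have path: "T.apath (head (traversals G) a) p w"
    and fresh: "tail (traversals G) a \<notin> set (T.awalk_verts (head (traversals G) a) p)"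
    by (auto simp: T.apath_Cons_iff)
  have "fst a \<noteq> fst b" if "b \<in> set p" for b
  proof
    assume same: "fst a = fst b"
    have "tail (traversals G) a \<in> {tail (traversals G) b, head (traversals G) b}"
      using same by (auto simp: traversals_def split: prod.splits)
    moreover have "tail (traversals G) b \<in> set (T.awalk_verts (head (traversals G) a) p)"
      using that by (rule T.awalk_verts_arc1)
    moreover have "head (traversals G) b \<in> set (T.awalk_verts (head (traversals G) a) p)"
      using T.awalkI_apath[OF path] that by (rule T.awalk_verts_arc2)
    ultimately show False using fresh by auto
  qed
  then show ?case using Cons.IH[OF path] by auto
qed

lemma wf_digraph_traversals: "wf_digraph G \<Longrightarrow> wf_digraph (traversals G)"
  by (auto simp: wf_digraph_def traversals_def)

text \<open>
  Representative phases \<open>0\<close> and, on internal--Neumann edges, \<open>pi / 2\<close>: every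
  internal--internal parity is \<open>+1\<close>.
\<close>

definition even_sector :: "('v, 'e::finite) bc_graph \<Rightarrow> real ^ 'e" where
  "even_sector M =
     (\<chi> e. if head (skel M) e \<in> vext M \<and> bc M (head (skel M) e) = Neumann then pi / 2 else 0)"

lemma even_sector_singular: "even_sector M \<in> singular_sectors M"
  unfolding singular_sectors_def even_sector_def vext_def
  by (auto intro: exI[of _ 0])

lemma scar_matrix_even_sector:
  "v \<in> vint M \<Longrightarrow> scar_matrix M (even_sector M) v = incidence (skel M) v"
  by (auto simp: vec_eq_iff scar_matrix_def even_sector_def incidence_def vext_def)

lemma scar_kernel_even_sector:
  "A \<in> scar_kernel M (even_sector M) \<longleftrightarrow> (\<forall>v\<in>vint M. incidence (skel M) v \<bullet> A = 0)"
  by (simp add: scar_kernel_def scar_matrix_even_sector inner_vec_def)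

text \<open>
  All that the flow construction uses about a primitive edge set; cycles and exterior paths
  differ only in why their two ends impose no net divergence at an internal vertex.
\<close>

lemma primitive_edge_set_walk:
  assumes "metric_graph M" "primitive_edge_set M K"
  obtains p u w where "pre_digraph.cas (traversals (skel M)) u p w" "p \<noteq> []"
    "distinct (map fst p)" "K = fst ` set p" "u = w \<or> u \<in> vext M \<and> w \<in> vext M"
proof -
  have wf: "wf_digraph (traversals (skel M))"
    using assms(1) by (intro wf_digraph_traversals) (simp add: metric_graph_def fin_digraph_def)
  show thesis
    using assms(2) distinct_edges_of_apath[OF wf] that
    unfolding primitive_edge_set_def simple_cycle_def simple_exterior_path_def
      pre_digraph.cycle_def pre_digraph.apath_def pre_digraph.awalk_def
    by blast
qed

lemma primitive_scar_amplitude: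
  assumes "metric_graph M" "primitive_edge_set M K"
  obtains A where "A \<in> scar_kernel M (even_sector M)" "A \<noteq> 0"
    "hadamard_square A = edge_indicator K"
proof -
  obtain p u w where p: "pre_digraph.cas (traversals (skel M)) u p w" "p \<noteq> []"
    "distinct (map fst p)" "K = fst ` set p" and ends: "u = w \<or> u \<in> vext M \<and> w \<in> vext M"
    using assms by (rule primitive_edge_set_walk)
  have square: "hadamard_square (traversal_flow p) = edge_indicator K"
    using p(3,4) by (simp add: hadamard_square_def edge_indicator_def traversal_flow_squared)
  have "traversal_flow p $ fst (hd p) \<noteq> 0"
    using traversal_flow_squared[OF p(3), of "fst (hd p)"] p(2) by auto
  then have "traversal_flow p \<noteq> 0" by auto
  moreover have "traversal_flow p \<in> scar_kernel M (even_sector M)"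
    using ends
    by (auto simp: scar_kernel_even_sector incidence_inner_traversal_flow[OF p(1)] vext_def)
  ultimately show thesis using square that by blast
qed

lemma inner_edge_indicator: "len M \<bullet> edge_indicator K = total_length M K"
  by (simp add: inner_vec_def edge_indicator_def total_length_def if_distrib sum.If_cases cong: if_cong)

lemma arclength_intensity_in_scar_cone:
  assumes "metric_graph M" "\<theta> \<in> singular_sectors M" "A \<in> scar_kernel M \<theta>"
    and "hadamard_square A = edge_indicator K"
  shows "arclength_intensity M K \<in> scar_cone M"
proof -
  have "edge_indicator K \<in> scar_cone M"
    using assms(2-) unfolding scar_cone_def by (intro hull_inc) (metis UN_I image_eqI)
  moreover have "0 \<le> inverse (total_length M K)"
    using metric_graph.len_pos[OF assms(1)]
    by (simp add: total_length_def sum_nonneg less_imp_le)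
  ultimately show ?thesis
    unfolding arclength_intensity_def scar_cone_def
    by (rule convex_cone_hull_mul)
qed

theorem proposition4p12:
  fixes M :: "('v, 'e::finite) bc_graph"
  assumes "metric_graph M"
  shows "{arclength_intensity M K | K. primitive_edge_set M K} \<subseteq> scar_cone M \<and>
    (\<forall>K. (\<exists>p. simple_cycle M p \<and> K = fst ` set p) \<or>
          (\<exists>a b p. simple_exterior_path M a b p \<and> K = fst ` set p) \<longrightarrow>
      (\<exists>\<theta>\<in>singular_sectors M. \<exists>A\<in>scar_kernel M \<theta>.
         A \<noteq> 0 \<and>
         (\<forall>e. (A $ e)\<^sup>2 = (if e \<in> K then 1 else 0)) \<and>
         len M \<bullet> hadamard_square A = total_length M K \<and>
         inverse (total_length M K) *\<^sub>R hadamard_square A = arclength_intensity M K) \<and>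
      arclength_intensity M K \<in> scar_cone M)"
proof -
  have scar: "(\<exists>\<theta>\<in>singular_sectors M. \<exists>A\<in>scar_kernel M \<theta>.
         A \<noteq> 0 \<and>
         (\<forall>e. (A $ e)\<^sup>2 = (if e \<in> K then 1 else 0)) \<and>
         len M \<bullet> hadamard_square A = total_length M K \<and>
         inverse (total_length M K) *\<^sub>R hadamard_square A = arclength_intensity M K) \<and>
      arclength_intensity M K \<in> scar_cone M" if prim: "primitive_edge_set M K" for K
  proof -
    obtain A where A: "A \<in> scar_kernel M (even_sector M)" "A \<noteq> 0"
      and square: "hadamard_square A = edge_indicator K"
      using assms prim by (rule primitive_scar_amplitude)
    have "\<forall>e. (A $ e)\<^sup>2 = (if e \<in> K then 1 else 0)"
      using square by (simp add: hadamard_square_def edge_indicator_def vec_eq_iff)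
    moreover have "len M \<bullet> hadamard_square A = total_length M K"
      by (simp add: square inner_edge_indicator)
    moreover have "inverse (total_length M K) *\<^sub>R hadamard_square A = arclength_intensity M K"
      by (simp add: square arclength_intensity_def)
    moreover have "arclength_intensity M K \<in> scar_cone M"
      using assms even_sector_singular A(1) square by (rule arclength_intensity_in_scar_cone)
    ultimately show ?thesis using even_sector_singular A by blast
  qed
  then show ?thesis unfolding primitive_edge_set_def by blast
qed

end
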